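(* Let $n,m\ge3$ be odd integers, $S$ and $T$ 2-partitions of $\mathbb{Z}_n^*$ and $\mathbb{Z}_m^*$ respectively, and $X_m$ a nucleus of order $m$. Then an $X$-generated product $W^X_{ST}$ is a starter in $\mathbb{Z}_{mn}$ if and only if $X_m$ is subtractive in $\mathbb{Z}_m$, $S$ is a starter in $\mathbb{Z}_n$, and $T$ is a starter in $\mathbb{Z}_m$.
   Context: $\mathbb{Z}_k^*=\mathbb{Z}_k\setminus\{0\}$; a 2-partition of $\mathbb{Z}_k^*$ ($k$ odd) is a partition into unordered pairs $\{x_i,y_i\}$; it is a starter in $\mathbb{Z}_k$ if $\{\pm(x_i-y_i)\bmod k\}=\mathbb{Z}_k^*$. A nucleus of order $m$ is a set of ordered pairs $X_m=\{(u_i,v_i)\}_{i=1}^{m-1}\subset\mathbb{Z}_m^*\times\mathbb{Z}_m^*$ with $\{u_i\}=\{v_i\}=\mathbb{Z}_m^*$; it is subtractive if $\{(u_i-v_i)\bmod m: 1\le i\le m-1\}=\mathbb{Z}_m^*$. $X$-generated product: with $n=2q+1$, $m=2p+1$, let $\tilde S$ (resp. $\tilde T$) be any set of ordered pairs obtained by ordering each pair of $S$ (resp. $T$) in either way. $W^X_{ST}$ consists of the unordered pairs $\{nr+x,\ nt+y\}$ (mod $nm$, with $x,y$ represented in $\{0,\dots,n-1\}$) of two types: (i$_X$) one pair for each $(x,y)\in\tilde S$ and each $(r,t)\in\{(0,0)\}\cup X_m$; (ii$_X$) one pair for each $(r,t)\in\tilde T$ with $x=y=0$. *)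

theory Defs
  imports Main "HOL-Library.Disjoint_Sets"
begin

text \<open>
  The integers modulo \<open>k\<close> are represented by their least non-negative residues,
  i.e. by the integers in \<open>{0..<k}\<close>; an unordered pair is a two-element set.
\<close>

definition nonzero_residues :: "int \<Rightarrow> int set" where
  "nonzero_residues k = {0..<k} - {0}"

definition two_partition :: "int \<Rightarrow> int set set \<Rightarrow> bool" where
  "two_partition k P \<longleftrightarrow> partition_on (nonzero_residues k) P \<and> (\<forall>p\<in>P. card p = 2)"

definition signed_differences :: "int \<Rightarrow> int set set \<Rightarrow> int set" where
  "signed_differences k P = {(s * (x - y)) mod k | s x y. s \<in> {1, - 1} \<and> {x, y} \<in> P}"

definition starter :: "int \<Rightarrow> int set set \<Rightarrow> bool" where
  "starter k P \<longleftrightarrow> two_partition k P \<and> signed_differences k P = nonzero_residues k"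

definition nucleus :: "int \<Rightarrow> (int \<times> int) set \<Rightarrow> bool" where
  "nucleus m X \<longleftrightarrow>
     X \<subseteq> nonzero_residues m \<times> nonzero_residues m \<and> card X = nat (m - 1) \<and>
     fst ` X = nonzero_residues m \<and> snd ` X = nonzero_residues m"

definition subtractive :: "int \<Rightarrow> (int \<times> int) set \<Rightarrow> bool" where
  "subtractive m X \<longleftrightarrow> {(u - v) mod m | u v. (u, v) \<in> X} = nonzero_residues m"

text \<open>
  \<open>ordering_of P R\<close>: \<open>R\<close> arises from \<open>P\<close> by replacing each pair \<open>{x, y}\<close> by exactly
  one of \<open>(x, y)\<close> and \<open>(y, x)\<close>.
\<close>

definition ordering_of :: "int set set \<Rightarrow> (int \<times> int) set \<Rightarrow> bool" where
  "ordering_of P R \<longleftrightarrow> bij_betw (\<lambda>(x, y). {x, y}) R P"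

definition product_pairs ::
    "int \<Rightarrow> int \<Rightarrow> (int \<times> int) set \<Rightarrow> (int \<times> int) set \<Rightarrow> (int \<times> int) set \<Rightarrow> int set set" where
  "product_pairs n m S' T' X =
     {{(n * r + x) mod (n * m), (n * t + y) mod (n * m)} | x y r t.
        (x, y) \<in> S' \<and> (r, t) \<in> {(0, 0)} \<union> X} \<union>
     {{(n * r) mod (n * m), (n * t) mod (n * m)} | r t. (r, t) \<in> T'}"

text \<open>
  The product depends on the chosen orderings of the pairs of \<open>S\<close> and \<open>T\<close>, so it is a
  relation: \<open>W\<close> is one of the possible \<open>X\<close>-generated products of \<open>S\<close> and \<open>T\<close>.
\<close>

definition generated_product ::
    "int \<Rightarrow> int \<Rightarrow> int set set \<Rightarrow> int set set \<Rightarrow> (int \<times> int) set \<Rightarrow> int set set \<Rightarrow> bool" where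
  "generated_product n m S T X W \<longleftrightarrow>
     (\<exists>S' T'. ordering_of S S' \<and> ordering_of T T' \<and> W = product_pairs n m S' T' X)"

end

theory Submission
  imports Defs
begin

text \<open>
  Every difference occurring in \<open>W\<close> has the form \<open>n (r - t) + (x - y)\<close>. It is a multiple
  of \<open>n\<close> exactly for the pairs coming from \<open>T\<close>; for the others, its residue modulo \<open>n\<close> is a
  difference of \<open>S\<close> and its quotient by \<open>n\<close> is a difference of \<open>{(0, 0)} \<union> X\<close>.
  Since \<open>W\<close> is always a 2-partition, only the surjectivity of differences matters. The one
  step that needs counting is to recover \<open>X\<close> from \<open>W\<close>: if \<open>S\<close> is a starter, a residue modulo
  \<open>n\<close> determines the pair of \<open>S\<close> and the sign producing it, so that all the differences of
  \<open>W\<close> in one residue class arise from a single pair of \<open>S\<close>.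
\<close>

section \<open>Ordered pairs covering the nonzero residues\<close>

text \<open>A 2-partition with a chosen orientation of each pair. The last condition concludes
  equality of ordered pairs, so it encodes disjointness and also forbids \<open>(a, b)\<close> and
  \<open>(b, a)\<close> from both occurring.\<close>

definition ordered_partition :: "int \<Rightarrow> (int \<times> int) set \<Rightarrow> bool" where
  "ordered_partition k R \<longleftrightarrow>
     (\<forall>(a, b) \<in> R. a \<noteq> b \<and> a \<in> nonzero_residues k \<and> b \<in> nonzero_residues k) \<and>
     (\<forall>z \<in> nonzero_residues k. \<exists>p \<in> R. z \<in> {fst p, snd p}) \<and>
     (\<forall>p \<in> R. \<forall>q \<in> R. {fst p, snd p} \<inter> {fst q, snd q} \<noteq> {} \<longrightarrow> p = q)"

text \<open>Allowing both signs makes this set independent of the orientation of the pairs.\<close>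

definition differences :: "int \<Rightarrow> (int \<times> int) set \<Rightarrow> int set" where
  "differences k R = {(s * (a - b)) mod k | s a b. s \<in> {1, - 1} \<and> (a, b) \<in> R}"

lemma nonzero_residues_iff: "z \<in> nonzero_residues k \<longleftrightarrow> 0 < z \<and> z < k"
  by (auto simp: nonzero_residues_def)

lemma mod_in_nonzero_residues:
  "k > 0 \<Longrightarrow> z mod k \<in> nonzero_residues k \<longleftrightarrow> \<not> k dvd z"
  using pos_mod_bound[of k z] pos_mod_sign[of k z]
  by (auto simp: nonzero_residues_iff dvd_eq_mod_eq_0 order_less_le simp del: pos_mod_bound pos_mod_sign)

lemma nonzero_residues_congD:
  assumes "a \<in> nonzero_residues k" "b \<in> nonzero_residues k" "k dvd a - b"
  shows "a = b"
  using assms by (metis mod_eq_dvd_iff mod_pos_pos_trivial nonzero_residues_iff order_less_imp_le)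

lemma card_nonzero_residues: "card (nonzero_residues k) = nat (k - 1)"
proof -
  have "nonzero_residues k = {1..<k}" by (auto simp: nonzero_residues_iff)
  then show ?thesis by simp
qed

lemma finite_nonzero_residues: "finite (nonzero_residues k)"
  by (simp add: nonzero_residues_def)

section \<open>Passing between unordered and ordered pairs\<close>

lemma ordered_partition_of_ordering:
  assumes "two_partition k P" and "ordering_of P R"
  shows "ordered_partition k R"
proof -
  have P: "\<Union>P = nonzero_residues k" "disjoint P" "\<And>p. p \<in> P \<Longrightarrow> card p = 2"
    using assms(1) by (auto simp: two_partition_def partition_on_def)
  have inj: "inj_on (\<lambda>(x, y). {x, y}) R" and im: "(\<lambda>(x, y). {x, y}) ` R = P"
    using assms(2) by (auto simp: ordering_of_def bij_betw_def)
  have mem: "{fst p, snd p} \<in> P" if "p \<in> R" for p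
    using that im by force
  show ?thesis
    unfolding ordered_partition_def
  proof (intro conjI ballI impI)
    fix p assume "p \<in> R"
    from mem[OF this] show "case p of (a, b) \<Rightarrow> a \<noteq> b \<and> a \<in> nonzero_residues k \<and> b \<in> nonzero_residues k"
      using P(3)[of "{fst p, snd p}"] by (auto simp: P(1)[symmetric] split: prod.splits)
  next
    fix z assume "z \<in> nonzero_residues k"
    then obtain A where "A \<in> P" "z \<in> A" unfolding P(1)[symmetric] by (rule UnionE)
    then obtain p where "p \<in> R" "z \<in> (case p of (x, y) \<Rightarrow> {x, y})" unfolding im[symmetric] by blast
    then show "\<exists>p\<in>R. z \<in> {fst p, snd p}" by (auto simp: case_prod_beta)
  next
    \<comment> \<open>Blocks of \<open>P\<close> that meet coincide, and injectivity of the ordering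
      lifts this to equality as ordered pairs.\<close>
    fix p q assume "p \<in> R" "q \<in> R" and ne: "{fst p, snd p} \<inter> {fst q, snd q} \<noteq> {}"
    then have "{fst p, snd p} = {fst q, snd q}"
      using disjointD[OF P(2) mem mem] by blast
    then show "p = q"
      using inj \<open>p \<in> R\<close> \<open>q \<in> R\<close> by (simp add: inj_on_def case_prod_beta)
  qed
qed

lemma two_partition_unordered:
  assumes "ordered_partition k R"
  shows "two_partition k ((\<lambda>(x, y). {x, y}) ` R)"
proof -
  have R: "\<And>a b. (a, b) \<in> R \<Longrightarrow> a \<noteq> b \<and> a \<in> nonzero_residues k \<and> b \<in> nonzero_residues k"
    "\<And>z. z \<in> nonzero_residues k \<Longrightarrow> \<exists>p \<in> R. z \<in> {fst p, snd p}"
    "\<And>p q. p \<in> R \<Longrightarrow> q \<in> R \<Longrightarrow> {fst p, snd p} \<inter> {fst q, snd q} \<noteq> {} \<Longrightarrow> p = q"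
    using assms by (auto simp: ordered_partition_def)
  have "\<Union>((\<lambda>(x, y). {x, y}) ` R) = nonzero_residues k"
    using R(1,2) by (fastforce simp: case_prod_beta)
  moreover have "disjoint ((\<lambda>(x, y). {x, y}) ` R)"
  proof (rule disjointI)
    fix A B
    assume A: "A \<in> (\<lambda>(x, y). {x, y}) ` R" and B: "B \<in> (\<lambda>(x, y). {x, y}) ` R" and "A \<noteq> B"
    then obtain p q where "p \<in> R" "q \<in> R" "A = {fst p, snd p}" "B = {fst q, snd q}"
      by (auto simp: case_prod_beta)
    then show "A \<inter> B = {}" using R(3) \<open>A \<noteq> B\<close> by blast
  qed
  ultimately show ?thesis
    using R(1) by (auto simp: two_partition_def partition_on_def)
qed

text \<open>A two-element set may be read in either order; reading it backwards is absorbed into the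
  sign \<open>s\<close>.\<close>

lemma signed_differences_unordered:
  "signed_differences k ((\<lambda>(x, y). {x, y}) ` R) = differences k R"
proof
  show "differences k R \<subseteq> signed_differences k ((\<lambda>(x, y). {x, y}) ` R)"
    unfolding signed_differences_def differences_def by force
  show "signed_differences k ((\<lambda>(x, y). {x, y}) ` R) \<subseteq> differences k R"
  proof
    fix z assume "z \<in> signed_differences k ((\<lambda>(x, y). {x, y}) ` R)"
    then have "\<exists>s x y. z = (s * (x - y)) mod k \<and> s \<in> {1, - 1} \<and> {x, y} \<in> (\<lambda>(x, y). {x, y}) ` R"
      unfolding signed_differences_def by (rule CollectD)
    then obtain s x y where z: "z = (s * (x - y)) mod k" and s: "s \<in> {1, - 1}"
      and "{x, y} \<in> (\<lambda>(x, y). {x, y}) ` R"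
      by (elim exE conjE)
    then obtain a b where ab: "(a, b) \<in> R" and "{x, y} = {a, b}" by auto
    then consider "x = a" "y = b" | "x = b" "y = a" by (auto simp: doubleton_eq_iff)
    then show "z \<in> differences k R"
    proof cases
      case 1
      then show ?thesis using z s ab by (auto simp: differences_def)
    next
      case 2
      then have "z = (- s * (a - b)) mod k" using z by (simp add: algebra_simps)
      moreover have "- s \<in> {1, - 1}" using s by auto
      ultimately show ?thesis using ab unfolding differences_def by blast
    qed
  qed
qed

section \<open>Differences and counting\<close>

lemma differences_subset:
  assumes "ordered_partition k R"
  shows "differences k R \<subseteq> nonzero_residues k"
proof
  fix z assume "z \<in> differences k R"
  then obtain s a b where z: "z = (s * (a - b)) mod k" and s: "s \<in> {1, - 1}" and ab: "(a, b) \<in> R"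
    unfolding differences_def by auto
  have *: "a \<noteq> b" "a \<in> nonzero_residues k" "b \<in> nonzero_residues k"
    using assms ab by (auto simp: ordered_partition_def)
  then have "\<not> k dvd a - b" using nonzero_residues_congD by blast
  then have "\<not> k dvd s * (a - b)" using s by (auto simp: dvd_diff_commute)
  moreover have "k > 0" using * by (simp add: nonzero_residues_iff)
  ultimately show "z \<in> nonzero_residues k" using z mod_in_nonzero_residues by blast
qed

text \<open>The partition property and the inclusion of the differences in the nonzero residues are
  automatic, which leaves surjectivity as the only condition to check.\<close>

lemma starter_iff_differences:
  assumes "ordered_partition k R"
  shows "starter k ((\<lambda>(x, y). {x, y}) ` R) \<longleftrightarrow> nonzero_residues k \<subseteq> differences k R"
  using two_partition_unordered[OF assms] differences_subset[OF assms]
  by (auto simp: starter_def signed_differences_unordered)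

lemma finite_ordered_partition:
  assumes "ordered_partition k R"
  shows "finite R"
proof (rule finite_subset)
  show "R \<subseteq> nonzero_residues k \<times> nonzero_residues k"
    using assms by (auto simp: ordered_partition_def)
qed (simp add: finite_nonzero_residues)

lemma card_ordered_partition:
  assumes "ordered_partition k R"
  shows "2 * card R = card (nonzero_residues k)"
proof -
  have "nonzero_residues k = (\<Union>p\<in>R. {fst p, snd p})"
    using assms unfolding ordered_partition_def by fastforce
  also have "card \<dots> = (\<Sum>p\<in>R. card {fst p, snd p})"
    using assms finite_ordered_partition[OF assms]
    by (intro card_UN_disjoint) (auto simp: ordered_partition_def)
  also have "\<dots> = (\<Sum>p\<in>R. 2)"
    using assms by (intro sum.cong) (auto simp: ordered_partition_def)
  finally show ?thesis by simp
qed

text \<open>There are \<open>2 * card R\<close> choices of a sign and a pair, exactly as many as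
  nonzero residues, so the difference map, once onto, is injective.\<close>

lemma differences_inj:
  assumes R: "ordered_partition k R" and sub: "nonzero_residues k \<subseteq> differences k R"
    and mem: "(a, b) \<in> R" "(c, d) \<in> R" "s \<in> {1, - 1}" "u \<in> {1, - 1}"
    and eq: "(s * (a - b)) mod k = (u * (c - d)) mod k"
  shows "s = u \<and> a = c \<and> b = d"
proof -
  let ?f = "\<lambda>(s, a, b). (s * (a - b)) mod k" and ?D = "{1, - 1 :: int} \<times> R"
  have "finite ?D" using finite_ordered_partition[OF R] by simp
  moreover have "?f ` ?D = nonzero_residues k"
  proof -
    have "?f ` ?D = differences k R" unfolding differences_def by force
    then show ?thesis using sub differences_subset[OF R] by simp
  qed
  moreover have "card (nonzero_residues k) = card ?D"
    using card_ordered_partition[OF R] by (simp add: card_cartesian_product)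
  ultimately have "inj_on ?f ?D" by (metis eq_card_imp_inj_on)
  then show ?thesis using inj_onD[of ?f ?D "(s, a, b)" "(u, c, d)"] mem eq by simp
qed

section \<open>The generated product\<close>

text \<open>The product with its orientation kept and without reduction modulo \<open>n * m\<close>:
  each entry is written by its quotient and remainder on division by \<open>n\<close>.\<close>

definition lifted_pairs ::
    "int \<Rightarrow> (int \<times> int) set \<Rightarrow> (int \<times> int) set \<Rightarrow> (int \<times> int) set \<Rightarrow> (int \<times> int) set" where
  "lifted_pairs n S' T' X =
     {(n * r + x, n * t + y) | x y r t. (x, y) \<in> S' \<and> (r, t) \<in> insert (0, 0) X} \<union>
     {(n * r, n * t) | r t. (r, t) \<in> T'}"

lemma lifted_pairsE:
  assumes "(a, b) \<in> lifted_pairs n S' T' X"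
  obtains x y r t where "a = n * r + x" "b = n * t + y" "(x, y) \<in> S'" "(r, t) \<in> insert (0, 0) X"
  | r t where "a = n * r" "b = n * t" "(r, t) \<in> T'"
  using assms unfolding lifted_pairs_def by blast

section \<open>Division with remainder by \<open>n\<close>\<close>

lemma lift_bounds:
  fixes n m r x :: int
  assumes "0 \<le> x" "x < n" "0 \<le> r" "r < m"
  shows "0 \<le> n * r + x" "n * r + x < n * m"
proof -
  show "0 \<le> n * r + x" using assms by simp
  have "n * r + x < n * (r + 1)" using assms by (simp add: algebra_simps)
  also have "\<dots> \<le> n * m" using assms by (intro mult_left_mono) auto
  finally show "n * r + x < n * m" .
qed

lemma lift_eq_iff:
  fixes n r x r' x' :: int
  assumes "0 \<le> x" "x < n" "0 \<le> x'" "x' < n"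
  shows "n * r + x = n * r' + x' \<longleftrightarrow> r = r' \<and> x = x'"
proof
  assume e: "n * r + x = n * r' + x'"
  then have "(n * r + x) div n = (n * r' + x') div n" by simp
  with assms have "r = r'" by simp
  with e show "r = r' \<and> x = x'" by simp
qed simp

section \<open>The product as a 2-partition\<close>

context
  fixes n m :: int and S' T' X :: "(int \<times> int) set"
  assumes n: "n \<ge> 2" and m: "m \<ge> 2"
    and S': "ordered_partition n S'" and T': "ordered_partition m T'" and X: "nucleus m X"
begin

lemma S'_range:
  assumes "(x, y) \<in> S'"
  shows "x \<noteq> y" "0 < x" "x < n" "0 < y" "y < n"
  using assms S' by (auto simp: ordered_partition_def nonzero_residues_iff)

lemma T'_range:
  assumes "(r, t) \<in> T'"
  shows "r \<noteq> t" "0 < r" "r < m" "0 < t" "t < m"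
  using assms T' by (auto simp: ordered_partition_def nonzero_residues_iff)

lemma insert_nucleus_range:
  assumes "(r, t) \<in> insert (0, 0) X"
  shows "0 \<le> r" "r < m" "0 \<le> t" "t < m"
  using assms X m by (auto simp: nucleus_def nonzero_residues_iff)

lemma finite_nucleus: "finite X"
  using X unfolding nucleus_def by (meson finite_SigmaI finite_nonzero_residues finite_subset)

text \<open>\<open>X\<close> has as many pairs as there are nonzero residues, so both projections,
  being onto, are injective. They miss 0, so adjoining \<open>(0, 0)\<close> preserves
  injectivity.\<close>

lemma nucleus_inj: "inj_on fst (insert (0, 0) X)" "inj_on snd (insert (0, 0) X)"
proof -
  have "inj_on fst X" "inj_on snd X"
    using X finite_nucleus by (auto intro!: eq_card_imp_inj_on simp: nucleus_def card_nonzero_residues)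
  moreover have "0 \<notin> fst ` X" "0 \<notin> snd ` X"
    using X by (auto simp: nucleus_def nonzero_residues_iff)
  ultimately show "inj_on fst (insert (0, 0) X)" "inj_on snd (insert (0, 0) X)"
    by (auto simp: inj_on_insert)
qed

lemma nucleus_surj_fst:
  assumes "0 \<le> r" "r < m" shows "\<exists>t. (r, t) \<in> insert (0, 0) X"
proof (cases "r = 0")
  case False
  then have "r \<in> fst ` X" using X assms by (auto simp: nucleus_def nonzero_residues_iff)
  then show ?thesis by force
qed auto

lemma nucleus_surj_snd:
  assumes "0 \<le> t" "t < m" shows "\<exists>r. (r, t) \<in> insert (0, 0) X"
proof (cases "t = 0")
  case False
  then have "t \<in> snd ` X" using X assms by (auto simp: nucleus_def nonzero_residues_iff)
  then show ?thesis by force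
qed auto

lemma lifted_pairs_range:
  assumes "(a, b) \<in> lifted_pairs n S' T' X"
  shows "a \<noteq> b" "0 < a" "a < n * m" "0 < b" "b < n * m"
proof -
  have "a \<noteq> b \<and> 0 < a \<and> a < n * m \<and> 0 < b \<and> b < n * m"
    using assms
  proof (cases rule: lifted_pairsE)
    case (1 x y r t)
    note x = S'_range[OF 1(3)] and r = insert_nucleus_range[OF 1(4)]
    have "0 \<le> n * r" "0 \<le> n * t" using n r by auto
    with x have "0 < n * r + x" "0 < n * t + y" by linarith+
    then show ?thesis
      using x r 1(1,2) lift_bounds[of x n r m] lift_bounds[of y n t m] lift_eq_iff[of x n y r t]
      by auto
  next
    case (2 r t)
    then show ?thesis using T'_range[OF 2(3)] n by auto
  qed
  then show "a \<noteq> b" "0 < a" "a < n * m" "0 < b" "b < n * m" by auto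
qed

text \<open>Divide \<open>z\<close> by \<open>n\<close>. If the remainder is 0, the quotient lies in
  a pair of \<open>T'\<close>; otherwise the remainder lies in a pair of \<open>S'\<close> and the
  quotient in a pair of the extended nucleus.\<close>

lemma lifted_pairs_cover:
  assumes "0 < z" "z < n * m"
  shows "\<exists>p \<in> lifted_pairs n S' T' X. z \<in> {fst p, snd p}"
proof -
  define x r where "x = z mod n" and "r = z div n"
  have z: "z = n * r + x" by (simp add: x_def r_def)
  have x: "0 \<le> x" "x < n" using n by (auto simp: x_def)
  have "0 \<le> r" using assms n by (simp add: r_def pos_imp_zdiv_nonneg_iff)
  moreover have "n * r < n * m" using z x assms by linarith
  then have "r < m" using n by simp
  ultimately have r: "0 \<le> r" "r < m" by auto
  show ?thesis
  proof (cases "x = 0")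
    case True
    then have "r \<in> nonzero_residues m" using r z assms by (auto simp: nonzero_residues_iff order_less_le)
    then obtain p where "p \<in> T'" "r \<in> {fst p, snd p}" using T' by (auto simp: ordered_partition_def)
    moreover from this have "(n * fst p, n * snd p) \<in> lifted_pairs n S' T' X"
      unfolding lifted_pairs_def by force
    moreover from calculation have "z \<in> {n * fst p, n * snd p}"
      using True z by auto
    ultimately have "(n * fst p, n * snd p) \<in> lifted_pairs n S' T' X" "z \<in> {n * fst p, n * snd p}"
      by blast+
    then show ?thesis by force
  next
    case False
    then have "x \<in> nonzero_residues n" using x by (auto simp: nonzero_residues_iff)
    then obtain p where "p \<in> S'" "x \<in> {fst p, snd p}" using S' by (auto simp: ordered_partition_def)
    \<comment> \<open>The coordinate of \<open>x\<close> in its pair decides which projection of the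
      nucleus has to hit \<open>r\<close>.\<close>
    then consider y where "(x, y) \<in> S'" | y where "(y, x) \<in> S'" by (cases p) auto
    then show ?thesis
    proof cases
      case (1 y)
      obtain t where "(r, t) \<in> insert (0, 0) X" using nucleus_surj_fst r by blast
      with 1 have "(n * r + x, n * t + y) \<in> lifted_pairs n S' T' X"
        unfolding lifted_pairs_def by blast
      then show ?thesis using z by force
    next
      case (2 y)
      obtain t where "(t, r) \<in> insert (0, 0) X" using nucleus_surj_snd r by blast
      with 2 have "(n * t + y, n * r + x) \<in> lifted_pairs n S' T' X"
        unfolding lifted_pairs_def by blast
      then show ?thesis using z by force
    qed
  qed
qed

text \<open>The remainder of the shared entry modulo \<open>n\<close> reveals the type of both
  pairs. For the first type it also fixes the pair of \<open>S'\<close>, after which the quotient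
  fixes \<open>(r, t)\<close>; for the second type the quotient fixes the pair of
  \<open>T'\<close>.\<close>

lemma lifted_pairs_unique:
  assumes "p \<in> lifted_pairs n S' T' X" "q \<in> lifted_pairs n S' T' X"
    and z: "z \<in> {fst p, snd p}" "z \<in> {fst q, snd q}"
  shows "p = q"
proof -
  \<comment> \<open>Coordinate form of disjointness, for arbitrary \<open>k\<close> and
    \<open>R\<close> so that it serves both \<open>S'\<close> and \<open>T'\<close>.\<close>
  have overlap: "(x, y) = (x', y')"
    if "ordered_partition k R" "(x, y) \<in> R" "(x', y') \<in> R"
      "x = x' \<or> x = y' \<or> y = x' \<or> y = y'"
    for k R and x y x' y' :: int
  proof -
    have unique: "\<forall>p \<in> R. \<forall>q \<in> R. {fst p, snd p} \<inter> {fst q, snd q} \<noteq> {} \<longrightarrow> p = q"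
      using that(1) by (simp add: ordered_partition_def)
    have "{fst (x, y), snd (x, y)} \<inter> {fst (x', y'), snd (x', y')} \<noteq> {}"
      using that(4) by auto
    then show ?thesis using that(2,3) unique by blast
  qed
  obtain a b c d where pq: "p = (a, b)" "q = (c, d)" by (cases p, cases q) auto
  have ab: "(a, b) \<in> lifted_pairs n S' T' X" and cd: "(c, d) \<in> lifted_pairs n S' T' X"
    using assms pq by auto
  have meet: "a = c \<or> a = d \<or> b = c \<or> b = d" using z pq by auto
  from ab have "(a, b) = (c, d)"
  proof (cases rule: lifted_pairsE)
    case (1 x y r t)
    note ab1 = 1 and x = S'_range[OF 1(3)]
    show ?thesis using cd
    proof (cases rule: lifted_pairsE)
      case (1 x' y' r' t')
      note x' = S'_range[OF 1(3)]
      have eqs: "(n * r + x = n * r' + x') = (r = r' \<and> x = x')"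
        "(n * r + x = n * t' + y') = (r = t' \<and> x = y')"
        "(n * t + y = n * r' + x') = (t = r' \<and> y = x')"
        "(n * t + y = n * t' + y') = (t = t' \<and> y = y')"
        using x x' by (simp_all add: lift_eq_iff)
      have hit: "r = r' \<and> x = x' \<or> r = t' \<and> x = y' \<or> t = r' \<and> y = x' \<or> t = t' \<and> y = y'"
        using meet unfolding ab1(1,2) 1(1,2) eqs .
      then have xy: "(x, y) = (x', y')"
        using overlap[OF S' ab1(3) 1(3)] by argo
      \<comment> \<open>The crossed alternatives in \<open>hit\<close> would now force
        \<open>x = y\<close>.\<close>
      with hit x(1) have "r = r' \<or> t = t'" by auto
      then have "(r, t) = (r', t')"
        using inj_onD[OF nucleus_inj(1) _ ab1(4) 1(4), unfolded fst_conv]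
          inj_onD[OF nucleus_inj(2) _ ab1(4) 1(4), unfolded snd_conv] by argo
      then show ?thesis using xy ab1(1,2) 1(1,2) by simp
    next
      case (2 r' t')
      \<comment> \<open>Entries of the first type have nonzero remainder modulo \<open>n\<close>,
        those of the second type remainder 0.\<close>
      have "n * r + x \<noteq> n * v \<and> n * t + y \<noteq> n * v" for v
        using x lift_eq_iff[of x n 0 r v] lift_eq_iff[of y n 0 t v] by auto
      then show ?thesis using meet unfolding 1(1,2) 2(1,2) by metis
    qed
  next
    case (2 r t)
    note ab2 = 2
    show ?thesis using cd
    proof (cases rule: lifted_pairsE)
      case (1 x' y' r' t')
      note x' = S'_range[OF 1(3)]
      have "n * r' + x' \<noteq> n * v \<and> n * t' + y' \<noteq> n * v" for v
        using x' lift_eq_iff[of x' n 0 r' v] lift_eq_iff[of y' n 0 t' v] by auto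
      then show ?thesis using meet unfolding 1(1,2) 2(1,2) by metis
    next
      case (2 r' t')
      have "r = r' \<or> r = t' \<or> t = r' \<or> t = t'"
        using meet n unfolding ab2(1,2) 2(1,2) by simp
      then have "(r, t) = (r', t')"
        using overlap[OF T' ab2(3) 2(3)] by argo
      then show ?thesis using ab2(1,2) 2(1,2) by simp
    qed
  qed
  then show ?thesis using pq by simp
qed

lemma ordered_partition_lifted_pairs: "ordered_partition (n * m) (lifted_pairs n S' T' X)"
  unfolding ordered_partition_def
proof (intro conjI ballI impI)
  fix p assume "p \<in> lifted_pairs n S' T' X"
  then show "case p of (a, b) \<Rightarrow>
      a \<noteq> b \<and> a \<in> nonzero_residues (n * m) \<and> b \<in> nonzero_residues (n * m)"
    using lifted_pairs_range by (cases p) (simp add: nonzero_residues_iff)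
next
  fix z assume "z \<in> nonzero_residues (n * m)"
  then show "\<exists>p\<in>lifted_pairs n S' T' X. z \<in> {fst p, snd p}"
    using lifted_pairs_cover by (simp add: nonzero_residues_iff)
next
  fix p q assume "p \<in> lifted_pairs n S' T' X" "q \<in> lifted_pairs n S' T' X"
    and "{fst p, snd p} \<inter> {fst q, snd q} \<noteq> {}"
  then show "p = q" using lifted_pairs_unique[of p q] by blast
qed

text \<open>All entries already lie strictly between 0 and \<open>n * m\<close>, so the reductions
  in \<open>product_pairs\<close> change nothing.\<close>

lemma product_pairs_eq:
  "product_pairs n m S' T' X = (\<lambda>(x, y). {x, y}) ` lifted_pairs n S' T' X" (is "?L = ?R")
proof -
  have lift1: "(n * r + x) mod (n * m) = n * r + x \<and> (n * t + y) mod (n * m) = n * t + y"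
    if "(x, y) \<in> S'" "(r, t) \<in> insert (0, 0) X" for x y r t
  proof -
    have "(n * r + x, n * t + y) \<in> lifted_pairs n S' T' X"
      using that unfolding lifted_pairs_def by blast
    from lifted_pairs_range[OF this] show ?thesis by simp
  qed
  have lift2: "(n * r) mod (n * m) = n * r \<and> (n * t) mod (n * m) = n * t"
    if "(r, t) \<in> T'" for r t
  proof -
    have "(n * r, n * t) \<in> lifted_pairs n S' T' X"
      using that unfolding lifted_pairs_def by blast
    from lifted_pairs_range[OF this] show ?thesis by (metis mod_pos_pos_trivial less_imp_le)
  qed
  show ?thesis
  proof
    show "?L \<subseteq> ?R"
    proof
      fix A assume "A \<in> ?L"
      then consider x y r t where "(x, y) \<in> S'" "(r, t) \<in> insert (0, 0) X"
          "A = {(n * r + x) mod (n * m), (n * t + y) mod (n * m)}"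
        | r t where "(r, t) \<in> T'" "A = {(n * r) mod (n * m), (n * t) mod (n * m)}"
        unfolding product_pairs_def by auto
      then show "A \<in> ?R"
      proof cases
        case (1 x y r t)
        then have "(n * r + x, n * t + y) \<in> lifted_pairs n S' T' X" "A = {n * r + x, n * t + y}"
          using lift1 unfolding lifted_pairs_def by (blast, simp)
        then show ?thesis by force
      next
        case (2 r t)
        then have "(n * r, n * t) \<in> lifted_pairs n S' T' X" "A = {n * r, n * t}"
          using lift2 unfolding lifted_pairs_def by (blast, simp)
        then show ?thesis by force
      qed
    qed
    show "?R \<subseteq> ?L"
    proof
      fix A assume "A \<in> ?R"
      then obtain a b where A: "A = {a, b}" and "(a, b) \<in> lifted_pairs n S' T' X" by auto
      from this(2) show "A \<in> ?L"
      proof (cases rule: lifted_pairsE)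
        case (1 x y r t)
        then have "A = {(n * r + x) mod (n * m), (n * t + y) mod (n * m)}"
          using A lift1[OF 1(3,4)] by simp
        then show ?thesis using 1(3,4) unfolding product_pairs_def by blast
      next
        case (2 r t)
        then have "A = {(n * r) mod (n * m), (n * t) mod (n * m)}"
          using A by (simp only: lift2[OF 2(3)])
        then show ?thesis using 2(3) unfolding product_pairs_def by blast
      qed
    qed
  qed
qed

section \<open>Differences of the product\<close>

lemma differences_lifted_cases:
  assumes "d \<in> differences (n * m) (lifted_pairs n S' T' X)"
  obtains s x y r t where "s \<in> {1, - 1}" "(x, y) \<in> S'" "(r, t) \<in> insert (0, 0) X"
      "d = (s * (n * (r - t) + (x - y))) mod (n * m)" "\<not> n dvd d"
      "d mod n = (s * (x - y)) mod n"
  | s r t where "s \<in> {1, - 1}" "(r, t) \<in> T'" "d = n * ((s * (r - t)) mod m)"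
proof -
  obtain s a b where s: "s \<in> {1, - 1}" and ab: "(a, b) \<in> lifted_pairs n S' T' X"
    and d: "d = (s * (a - b)) mod (n * m)"
    using assms unfolding differences_def by auto
  from ab show ?thesis
  proof (cases rule: lifted_pairsE)
    case (1 x y r t)
    have d': "d = (s * (n * (r - t) + (x - y))) mod (n * m)"
      using d 1(1,2) by (simp add: algebra_simps)
    have "d mod n = (s * (n * (r - t) + (x - y))) mod n"
      using d' by (simp add: mod_mod_cancel)
    also have "s * (n * (r - t) + (x - y)) = s * (x - y) + n * (s * (r - t))"
      by (simp add: algebra_simps)
    finally have dn: "d mod n = (s * (x - y)) mod n" by simp
    \<comment> \<open>Differences of \<open>S'\<close> are nonzero modulo \<open>n\<close>, which
      keeps \<open>d\<close> off the multiples of \<open>n\<close>.\<close>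
    have "(s * (x - y)) mod n \<in> differences n S'"
      using s 1(3) by (auto simp: differences_def)
    then have "d mod n \<noteq> 0"
      using dn differences_subset[OF S'] by (auto simp: nonzero_residues_iff)
    then show ?thesis using that(1)[OF s 1(3,4) d'] dn by (auto simp: dvd_eq_mod_eq_0)
  next
    case (2 r t)
    have "s * (a - b) = n * (s * (r - t))" using 2 by (simp add: algebra_simps)
    then have "d = n * ((s * (r - t)) mod m)" using d by (simp only: mod_mult_mult1)
    then show ?thesis using that(2)[OF s 2(3)] by blast
  qed
qed

text \<open>From left to right, multiples of \<open>n\<close> test \<open>T'\<close>, numbers below
  \<open>n\<close> test \<open>S'\<close>, and the residue class of one fixed difference of
  \<open>S'\<close> tests \<open>X\<close>; \<open>ne\<close> provides that difference. From right
  to left, a difference is assembled from its residue and quotient.\<close>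

lemma lifted_differences_iff:
  assumes ne: "S' \<noteq> {}"
  shows "nonzero_residues (n * m) \<subseteq> differences (n * m) (lifted_pairs n S' T' X) \<longleftrightarrow>
    subtractive m X \<and> nonzero_residues n \<subseteq> differences n S' \<and> nonzero_residues m \<subseteq> differences m T'"
    (is "?W \<longleftrightarrow> ?X \<and> ?S \<and> ?T")
proof
  assume W: ?W
  have "n * m > 0" using n m by simp
  have "n \<le> n * m" using n m mult_left_mono[of 1 m n] by simp
  have ?T
  proof
    fix e assume e: "e \<in> nonzero_residues m"
    then have "n * e \<in> nonzero_residues (n * m)" using n by (auto simp: nonzero_residues_iff)
    with W have "n * e \<in> differences (n * m) (lifted_pairs n S' T' X)" by blast
    then show "e \<in> differences m T'"
    proof (cases rule: differences_lifted_cases)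
      \<comment> \<open>The first case contradicts divisibility of \<open>n * e\<close> by
        \<open>n\<close>; the closing \<open>qed\<close> discharges it.\<close>
      case (2 s r t)
      then have "e = (s * (r - t)) mod m" using n by simp
      then show ?thesis using 2(1,2) unfolding differences_def by blast
    qed (use dvd_triv_left in blast)
  qed
  moreover have S: ?S
  proof
    fix e assume e: "e \<in> nonzero_residues n"
    then have "e \<in> nonzero_residues (n * m)"
      using order_less_le_trans[OF _ \<open>n \<le> n * m\<close>] unfolding nonzero_residues_iff by blast
    with W have "e \<in> differences (n * m) (lifted_pairs n S' T' X)" by blast
    then show "e \<in> differences n S'"
    proof (cases rule: differences_lifted_cases)
      case (1 s x y r t)
      have "e mod n = e" using e by (auto simp: nonzero_residues_iff)
      then have "e = (s * (x - y)) mod n" using 1(6) by simp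
      then show ?thesis using 1(1,2) unfolding differences_def by blast
    next
      case (2 s r t)
      then have "n dvd e" by simp
      then show ?thesis using e by (auto simp: nonzero_residues_iff dest: zdvd_imp_le)
    qed
  qed
  moreover have ?X
  proof -
    let ?D = "(\<lambda>(u, v). (u - v) mod m) ` X"
    have "nonzero_residues m \<subseteq> ?D"
    proof
      fix e assume e: "e \<in> nonzero_residues m"
      obtain x y where xy: "(x, y) \<in> S'" using ne by auto
      note x = S'_range[OF xy]
      have nxy: "\<not> n dvd x - y"
        using nonzero_residues_congD[of x n y] x by (auto simp: nonzero_residues_iff)
      \<comment> \<open>The residue of \<open>d\<close> modulo \<open>n\<close> is that of
        \<open>x - y\<close>, while the target \<open>e\<close> is placed in the quotient.\<close>
      define d where "d = (n * e + (x - y)) mod (n * m)"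
      have dn: "d mod n = (x - y) mod n" by (simp add: d_def mod_mod_cancel)
      have "\<not> n dvd n * e + (x - y)" using nxy by (simp add: dvd_add_right_iff)
      then have "\<not> n * m dvd n * e + (x - y)" by (meson dvd_mult_left)
      then have "d \<in> nonzero_residues (n * m)"
        using \<open>n * m > 0\<close> by (simp add: d_def mod_in_nonzero_residues)
      with W have "d \<in> differences (n * m) (lifted_pairs n S' T' X)" by blast
      then show "e \<in> ?D"
      proof (cases rule: differences_lifted_cases)
        case (1 s x' y' r t)
        \<comment> \<open>The factor 1 is the sign to be compared with \<open>s\<close>: as
          \<open>S\<close> is already known to hold, sign and pair are forced.\<close>
        have "(1 * (x - y)) mod n = (s * (x' - y')) mod n" using dn 1(6) by simp
        then have "1 = s \<and> x = x' \<and> y = y'"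
          using differences_inj[OF S' S xy 1(2) _ 1(1)] by blast
        then have "(n * e + (x - y)) mod (n * m) = (n * (r - t) + (x - y)) mod (n * m)"
          using 1(4) d_def by simp
        then have "n * m dvd n * (e - (r - t))"
          by (simp add: mod_eq_dvd_iff algebra_simps)
        then have "m dvd e - (r - t)" using n by simp
        then have "e mod m = (r - t) mod m" by (simp add: mod_eq_dvd_iff)
        then have er: "e = (r - t) mod m" using e by (simp add: nonzero_residues_iff)
        \<comment> \<open>The adjoined pair only yields the difference 0, so \<open>(r, t)\<close>
          belongs to \<open>X\<close> itself.\<close>
        then have "(r, t) \<noteq> (0, 0)" using e by (auto simp: nonzero_residues_iff)
        then show ?thesis using 1(3) er by force
      next
        case (2 s r t)
        then show ?thesis using dn nxy by (simp add: dvd_eq_mod_eq_0)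
      qed
    qed
    \<comment> \<open>A priori \<open>?D\<close> might also contain 0; counting upgrades the
      inclusion to the equality that \<open>subtractive\<close> demands.\<close>
    moreover have "card ?D \<le> card (nonzero_residues m)"
      using X card_image_le[OF finite_nucleus, of "\<lambda>(u, v). (u - v) mod m"]
      by (simp add: nucleus_def card_nonzero_residues)
    ultimately have "?D = nonzero_residues m"
      using card_seteq[of ?D "nonzero_residues m"] finite_nucleus by blast
    moreover have "?D = {(u - v) mod m | u v. (u, v) \<in> X}" by force
    ultimately show ?thesis by (simp add: subtractive_def)
  qed
  ultimately show "?X \<and> ?S \<and> ?T" by blast
next
  assume "?X \<and> ?S \<and> ?T"
  then have X': ?X and S: ?S and T: ?T by auto
  show ?W
  proof
    fix d assume d: "d \<in> nonzero_residues (n * m)"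
    then have dmod: "d mod (n * m) = d" by (auto simp: nonzero_residues_iff)
    show "d \<in> differences (n * m) (lifted_pairs n S' T' X)"
    proof (cases "n dvd d")
      case True
      then obtain e where e: "d = n * e" by auto
      with d n have "e \<in> nonzero_residues m"
        by (auto simp: nonzero_residues_iff zero_less_mult_iff)
      with T obtain s r t where *: "s \<in> {1, - 1}" "(r, t) \<in> T'" "e = (s * (r - t)) mod m"
        unfolding differences_def by blast
      have "d = (s * (n * r - n * t)) mod (n * m)"
        using * e by (simp add: mult_mod_right algebra_simps)
      moreover have "(n * r, n * t) \<in> lifted_pairs n S' T' X"
        using * by (auto simp: lifted_pairs_def)
      ultimately show ?thesis using * unfolding differences_def by blast
    next
      case False
      then have "d mod n \<in> nonzero_residues n" using n by (simp add: mod_in_nonzero_residues)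
      with S obtain s x y where s: "s \<in> {1, - 1}" and xy: "(x, y) \<in> S'"
        and "d mod n = (s * (x - y)) mod n"
        unfolding differences_def by blast
      then have "n dvd d - s * (x - y)" by (simp add: mod_eq_dvd_iff)
      then obtain e where e: "d - s * (x - y) = n * e" by auto
      have ss: "s * s = 1" using s by auto
      \<comment> \<open>The sign \<open>s\<close> is fixed by the residue modulo \<open>n\<close>
        and applies to the quotients as well, so the nucleus has to realise \<open>s * e\<close>;
        multiplying by \<open>s\<close> again recovers \<open>e\<close>.\<close>
      have "\<exists>r t. (r, t) \<in> insert (0, 0) X \<and> (s * e) mod m = (r - t) mod m"
      proof (cases "m dvd s * e")
        case True
        \<comment> \<open>Subtractivity does not reach the class 0; the adjoined pair
          \<open>(0, 0)\<close> supplies it.\<close>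
        then show ?thesis by (intro exI[of _ 0]) (simp add: dvd_eq_mod_eq_0)
      next
        case False
        then have "(s * e) mod m \<in> nonzero_residues m" using m by (simp add: mod_in_nonzero_residues)
        then show ?thesis using X' unfolding subtractive_def by blast
      qed
      then obtain r t where rt: "(r, t) \<in> insert (0, 0) X" and "m dvd s * e - (r - t)"
        by (auto simp: mod_eq_dvd_iff)
      then obtain k where k: "s * e - (r - t) = m * k" by auto
      then have "s * (s * e) = s * (r - t + m * k)" by simp
      then have ek: "e = s * (r - t + m * k)" using ss by (simp flip: mult.assoc)
      have "d = n * e + s * (x - y)" using e by simp
      also have "\<dots> = s * ((n * r + x) - (n * t + y)) + n * m * (s * k)"
        unfolding ek by (simp add: algebra_simps)
      finally have "d mod (n * m) = (s * ((n * r + x) - (n * t + y))) mod (n * m)" by simp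
      moreover have "(n * r + x, n * t + y) \<in> lifted_pairs n S' T' X"
        using xy rt unfolding lifted_pairs_def by blast
      ultimately show ?thesis using s unfolding differences_def dmod by blast
    qed
  qed
qed

end

theorem theorem3p17:
  fixes n m :: int
    and S T W :: "int set set"
    and X :: "(int \<times> int) set"
  assumes "n \<ge> 3" and "odd n"
    and "m \<ge> 3" and "odd m"
    and "two_partition n S"
    and "two_partition m T"
    and "nucleus m X"
    and "generated_product n m S T X W"
  shows "starter (m * n) W \<longleftrightarrow> subtractive m X \<and> starter n S \<and> starter m T"
proof -
  obtain S' T' where oS: "ordering_of S S'" and oT: "ordering_of T T'"
    and W: "W = product_pairs n m S' T' X"
    using assms unfolding generated_product_def by blast
  have S': "ordered_partition n S'" and T': "ordered_partition m T'"
    using ordered_partition_of_ordering assms oS oT by blast+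
  have S: "S = (\<lambda>(x, y). {x, y}) ` S'" and T: "T = (\<lambda>(x, y). {x, y}) ` T'"
    using oS oT by (auto simp: ordering_of_def bij_betw_def)
  have "1 \<in> nonzero_residues n" using assms by (simp add: nonzero_residues_iff)
  \<comment> \<open>Some pair of \<open>S'\<close> must cover the residue 1.\<close>
  then have ne: "S' \<noteq> {}" using S' unfolding ordered_partition_def by blast
  have n: "n \<ge> 2" and m: "m \<ge> 2" using assms by auto
  note ctxt = n m S' T' \<open>nucleus m X\<close>
  have "starter (m * n) W \<longleftrightarrow>
      nonzero_residues (n * m) \<subseteq> differences (n * m) (lifted_pairs n S' T' X)"
    unfolding W product_pairs_eq[OF ctxt] mult.commute[of m n]
    by (rule starter_iff_differences[OF ordered_partition_lifted_pairs[OF ctxt]])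
  also have "\<dots> \<longleftrightarrow> subtractive m X \<and> starter n S \<and> starter m T"
    unfolding S T starter_iff_differences[OF S'] starter_iff_differences[OF T']
    by (rule lifted_differences_iff[OF ctxt ne])
  finally show ?thesis .
qed

end
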